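(* Let $2 \le m \le n$ and let $G$ and $H$ be connected graphs of orders $m$ and $n$, respectively. For every integer $k \ge 1$, $$d_k(G \Box H) \ge \min\{\, n + \delta(G) - 1,\ m + \delta(H) - 1 \,\}.$$
   Context: $\delta(\cdot)$ is the minimum degree. $G \Box H$ is the Cartesian product: vertex set $V(G)\times V(H)$, with $(x,y)$ adjacent to $(u,v)$ iff ($x=u$ and $yv \in E(H)$) or ($xu \in E(G)$ and $y=v$). The $k$-move deduction game ($k$ a positive integer) on a finite graph $G$: a layout places a finite number of searchers on vertices of $G$ (several searchers may share a vertex). Every searcher is initially mobile. A vertex is protected once it has been occupied by some searcher (so initially occupied vertices are protected); other vertices are unprotected. The game proceeds in stages. At each stage, for every vertex $v$ that has at least one unprotected neighbour: if the number of mobile searchers on $v$ is at least the number of unprotected neighbours of $v$, then the mobile searchers on $v$ move to the unprotected neighbours of $v$ so that each unprotected neighbour receives at least one searcher; excess mobile searchers on $v$ may also move to any of these unprotected neighbours. All moves in a stage happen simultaneously, newly occupied vertices become protected, and a searcher that has moved $k$ times becomes immobile. The process repeats until all vertices are protected or no searcher can move. A layout is successful if all vertices of $G$ end up protected. The $k$-move deduction number $d_k(G)$ is the minimum number of searchers in a successful layout on $G$. *)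

theory Defs
  imports "Graph_Theory.Graph_Theory"
begin

text \<open>
  A finite simple graph is a \<^locale>\<open>pair_graph\<close>: finitely many vertices, no loops, and a
  symmetric arc relation, so an edge \<open>uv\<close> is present as both \<open>(u, v)\<close> and \<open>(v, u)\<close>, and
  \<^const>\<open>out_degree\<close> is the usual degree.
\<close>

definition min_degree :: "'a pair_pre_digraph \<Rightarrow> nat" where
  "min_degree G = Min (out_degree G ` pverts G)"

definition cartesian_product ::
    "'a pair_pre_digraph \<Rightarrow> 'b pair_pre_digraph \<Rightarrow> ('a \<times> 'b) pair_pre_digraph" where
  "cartesian_product G H =
     \<lparr> pverts = pverts G \<times> pverts H,
       parcs = {((x, y), (u, v)) | x y u v.
                  (x \<in> pverts G \<and> x = u \<and> (y, v) \<in> parcs H) \<or>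
                  ((x, u) \<in> parcs G \<and> y \<in> pverts H \<and> y = v)} \<rparr>"

lemma pair_graph_cartesian_product:
  assumes "pair_graph G" "pair_graph H"
  shows "pair_graph (cartesian_product G H)"
proof -
  interpret G: pair_graph G by fact
  interpret H: pair_graph H by fact
  have symG: "(a, b) \<in> parcs G \<Longrightarrow> (b, a) \<in> parcs G" for a b
    using G.pair_sym_arcs by (auto simp: symmetric_def dest: symD)
  have symH: "(a, b) \<in> parcs H \<Longrightarrow> (b, a) \<in> parcs H" for a b
    using H.pair_sym_arcs by (auto simp: symmetric_def dest: symD)
  have wf: "fst e \<in> pverts (cartesian_product G H) \<and> snd e \<in> pverts (cartesian_product G H)"
    if "e \<in> parcs (cartesian_product G H)" for e
    using that by (auto simp: cartesian_product_def dest: G.wellformed' H.wellformed')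
  have fin: "finite (pverts (cartesian_product G H))"
    by (simp add: cartesian_product_def G.pair_finite_verts H.pair_finite_verts)
  have "parcs (cartesian_product G H)
      \<subseteq> pverts (cartesian_product G H) \<times> pverts (cartesian_product G H)"
    using wf by (auto simp: mem_Times_iff)
  then have "finite (parcs (cartesian_product G H))"
    using fin by (meson finite_SigmaI finite_subset)
  moreover have "symmetric (cartesian_product G H)"
    by (auto simp: symmetric_def sym_def cartesian_product_def intro: symG symH)
  moreover have "fst e \<noteq> snd e" if "e \<in> parcs (cartesian_product G H)" for e
    using that by (auto simp: cartesian_product_def dest: G.pair_no_loops H.pair_no_loops)
  ultimately show ?thesis
    using wf fin by unfold_locales auto
qed

text \<open>
  The \<open>s\<close> searchers are the numbers below \<open>s\<close>; the values of \<open>place\<close> and \<open>moves\<close> at other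
  arguments are irrelevant.  \<open>place i\<close> is the vertex occupied by searcher \<open>i\<close>, \<open>moves i\<close> is
  how often \<open>i\<close> has moved so far, and \<open>prot\<close> is the set of protected vertices.
\<close>

record 'a game_state =
  place :: "nat \<Rightarrow> 'a"
  moves :: "nat \<Rightarrow> nat"
  prot :: "'a set"

definition unprotected_neighbours :: "'a pair_pre_digraph \<Rightarrow> 'a game_state \<Rightarrow> 'a \<Rightarrow> 'a set" where
  "unprotected_neighbours G c v = {u. (v, u) \<in> parcs G \<and> u \<notin> prot c}"

definition mobile_on :: "nat \<Rightarrow> nat \<Rightarrow> 'a game_state \<Rightarrow> 'a \<Rightarrow> nat set" where
  "mobile_on k s c v = {i. i < s \<and> place c i = v \<and> moves c i < k}"

definition fires :: "nat \<Rightarrow> nat \<Rightarrow> 'a pair_pre_digraph \<Rightarrow> 'a game_state \<Rightarrow> 'a \<Rightarrow> bool" where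
  "fires k s G c v \<longleftrightarrow>
     v \<in> pverts G \<and> unprotected_neighbours G c v \<noteq> {} \<and>
     card (unprotected_neighbours G c v) \<le> card (mobile_on k s c v)"

definition stays :: "'a game_state \<Rightarrow> 'a game_state \<Rightarrow> nat \<Rightarrow> bool" where
  "stays c c' i \<longleftrightarrow> place c' i = place c i \<and> moves c' i = moves c i"

definition moves_to :: "'a game_state \<Rightarrow> 'a game_state \<Rightarrow> nat \<Rightarrow> 'a \<Rightarrow> bool" where
  "moves_to c c' i u \<longleftrightarrow> place c' i = u \<and> moves c' i = Suc (moves c i)"

text \<open>
  One stage.  Every vertex that can fire must do so, and all firings are evaluated in the old
  state \<open>c\<close>.  The relation is not functional: it leaves open which mobile searcher goes to which
  unprotected neighbour, and whether an excess searcher moves or stays.  If no vertex can fire,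
  in particular if every vertex is protected, a stage changes nothing.
\<close>

definition stage ::
    "nat \<Rightarrow> nat \<Rightarrow> 'a pair_pre_digraph \<Rightarrow> 'a game_state \<Rightarrow> 'a game_state \<Rightarrow> bool" where
  "stage k s G c c' \<longleftrightarrow>
     (\<forall>v. fires k s G c v \<longrightarrow>
        (\<forall>i \<in> mobile_on k s c v.
           stays c c' i \<or> (\<exists>u \<in> unprotected_neighbours G c v. moves_to c c' i u)) \<and>
        (\<forall>u \<in> unprotected_neighbours G c v. \<exists>i \<in> mobile_on k s c v. moves_to c c' i u)) \<and>
     (\<forall>i < s. (\<nexists>v. fires k s G c v \<and> i \<in> mobile_on k s c v) \<longrightarrow> stays c c' i) \<and>
     prot c' = prot c \<union> place c' ` {..<s}"

definition initial_state :: "nat \<Rightarrow> (nat \<Rightarrow> 'a) \<Rightarrow> 'a game_state" where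
  "initial_state s L = \<lparr> place = L, moves = (\<lambda>_. 0), prot = L ` {..<s} \<rparr>"

text \<open>
  A layout is successful if the searchers can make their choices so that every vertex ends up
  protected.
\<close>

definition successful_layout ::
    "nat \<Rightarrow> nat \<Rightarrow> 'a pair_pre_digraph \<Rightarrow> (nat \<Rightarrow> 'a) \<Rightarrow> bool" where
  "successful_layout k s G L \<longleftrightarrow>
     L ` {..<s} \<subseteq> pverts G \<and>
     (\<exists>c. (stage k s G)\<^sup>*\<^sup>* (initial_state s L) c \<and> pverts G \<subseteq> prot c)"

definition deduction_number :: "nat \<Rightarrow> 'a pair_pre_digraph \<Rightarrow> nat" where
  "deduction_number k G = (LEAST s. \<exists>L. successful_layout k s G L)"

text \<open>The minimum is over a nonempty set: one searcher on every vertex is successful.\<close>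

lemma deduction_number_attained:
  assumes "finite (pverts G)"
  shows "\<exists>L. successful_layout k (deduction_number k G) G L"
proof -
  obtain L where "bij_betw L {0..<card (pverts G)} (pverts G)"
    using ex_bij_betw_nat_finite[OF assms] by blast
  then have "L ` {..<card (pverts G)} = pverts G"
    by (simp add: bij_betw_def atLeast0LessThan)
  then have "successful_layout k (card (pverts G)) G L"
    unfolding successful_layout_def
    by (intro conjI exI[of _ "initial_state (card (pverts G)) L"])
       (auto simp: initial_state_def)
  then show ?thesis
    unfolding deduction_number_def
    by (intro LeastI_ex[of "\<lambda>s. \<exists>L. successful_layout k s G L"]) blast
qed

end

theory Submission
  imports Defs
begin

text \<open>
  Order the vertices by the time at which they fire, those that never fire coming last, and let
  \<open>F\<close> be an initial segment.  A protected vertex that has not fired still carries a searcher, and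
  every neighbour of a fired vertex is protected, so the outer boundary of \<open>F\<close> never has more
  vertices than there are searchers.  Now add the vertices one by one to \<open>F\<close> and stop as soon as
  \<open>F\<close> meets every copy of \<open>G\<close>, or every copy of \<open>H\<close>; say the former, the last copy being met at
  \<open>(x, y)\<close>.  That copy contains the at least \<open>\<delta>(G)\<close> boundary vertices next to \<open>(x, y)\<close>.  No other
  copy of \<open>G\<close> lies inside \<open>F\<close>, since otherwise \<open>F\<close> would have met every copy of \<open>H\<close> earlier;
  being connected, each of these \<open>n - 1\<close> copies contains a boundary vertex.
\<close>

section \<open>Vertex orderings with small outer boundaries\<close>

definition outer_boundary :: "'a pair_pre_digraph \<Rightarrow> 'a set \<Rightarrow> 'a set" where
  "outer_boundary G F = parcs G `` F - F"

text \<open>The firing order with searchers, moves and \<open>k\<close> stripped away, which is why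
  the final bound does not depend on \<open>k\<close>.\<close>

inductive sweep :: "nat \<Rightarrow> 'a pair_pre_digraph \<Rightarrow> 'a set \<Rightarrow> bool" for s G where
  empty: "sweep s G {}"
| insert: "sweep s G F \<Longrightarrow> v \<in> pverts G \<Longrightarrow> v \<notin> F \<Longrightarrow>
    card (outer_boundary G (insert v F)) \<le> s \<Longrightarrow> sweep s G (insert v F)"

text \<open>Vertices that fire in the same stage have no order among themselves. Bounding the
  boundary for every subset \<open>B\<close> allows them to be added in any order.\<close>

lemma sweep_union:
  assumes "sweep s G F" "finite A" "A \<subseteq> pverts G"
    and "\<And>B. B \<subseteq> A \<Longrightarrow> card (outer_boundary G (F \<union> B)) \<le> s"
  shows "sweep s G (F \<union> A)"
  using assms(2-4)
proof (induction A rule: finite_induct)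
  case empty
  then show ?case using assms(1) by simp
next
  case (insert a A)
  have IH: "sweep s G (F \<union> A)"
    using insert.prems by (intro insert.IH) auto
  show ?case
  proof (cases "a \<in> F")
    case True
    then show ?thesis using IH by (simp add: insert_absorb)
  next
    case False
    then show ?thesis
      using sweep.insert[OF IH, of a] insert.hyps insert.prems(1) insert.prems(2)[of "insert a A"]
      by simp
  qed
qed

section \<open>From the game to a sweep\<close>

lemma card_le_of_subset_searchers:
  assumes "A \<subseteq> (g :: nat \<Rightarrow> 'a) ` {..<s}"
  shows "card A \<le> s"
  using card_mono[OF _ assms] card_image_le[of "{..<s}" g] by simp

text \<open>\<open>F\<close> stands for the vertices fired in earlier stages and \<open>A\<close>
  for those firing now. The invariants \<open>nb\<close> and \<open>occ\<close> place the outer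
  boundary of \<open>F\<close> on occupied vertices, and the stage carries both over to
  \<open>F \<union> A\<close>.\<close>

lemma sweep_stage:
  assumes "finite (pverts G)" and st: "stage k s G c c'"
    and "sweep s G F"
    and nb: "parcs G `` F \<subseteq> prot c"
    and occ: "prot c - F \<subseteq> place c ` {..<s}"
  defines "A \<equiv> {v. fires k s G c v}"
  shows "sweep s G (F \<union> A)"
    and "parcs G `` (F \<union> A) \<subseteq> prot c'"
    and "prot c' - (F \<union> A) \<subseteq> place c' ` {..<s}"
proof -
  have prot': "prot c' = prot c \<union> place c' ` {..<s}"
    using st by (simp add: stage_def)
  have sent: "\<exists>i<s. place c i = v \<and> place c' i = w"
    if "v \<in> A" "(v, w) \<in> parcs G" "w \<notin> prot c" for v w
  proof -
    have "w \<in> unprotected_neighbours G c v"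
      using that by (simp add: unprotected_neighbours_def)
    then obtain i where "i \<in> mobile_on k s c v" "moves_to c c' i w"
      using st \<open>v \<in> A\<close> unfolding stage_def A_def by blast
    then show ?thesis by (auto simp: mobile_on_def moves_to_def)
  qed
  have AV: "A \<subseteq> pverts G" by (auto simp: A_def fires_def)
  show "sweep s G (F \<union> A)"
  proof (rule sweep_union)
    show "sweep s G F" by fact
    show "finite A" using AV assms(1) by (rule finite_subset)
    show "A \<subseteq> pverts G" by fact
    fix B assume B: "B \<subseteq> A"
    \<comment> \<open>Positions in the hypothetical situation where only the vertices of
      \<open>B\<close> have fired: searchers on \<open>B\<close> have already made their move, all
      others are still in place.\<close>
    define g where "g i = (if place c i \<in> B then place c' i else place c i)" for i
    have "outer_boundary G (F \<union> B) \<subseteq> g ` {..<s}"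
    proof
      fix w assume "w \<in> outer_boundary G (F \<union> B)"
      then obtain v where v: "v \<in> F \<union> B" "(v, w) \<in> parcs G" and w: "w \<notin> F" "w \<notin> B"
        by (auto simp: outer_boundary_def)
      show "w \<in> g ` {..<s}"
      proof (cases "w \<in> prot c")
        case True
        then obtain i where "i < s" "place c i = w" using occ w by auto
        then show ?thesis using w by (auto simp: g_def intro!: image_eqI[of _ _ i])
      next
        case False
        then have "v \<in> B" using v nb by auto
        then obtain i where "i < s" "place c i = v" "place c' i = w"
          using sent[OF _ v(2) False] B by auto
        then show ?thesis using \<open>v \<in> B\<close> by (auto simp: g_def intro!: image_eqI[of _ _ i])
      qed
    qed
    then show "card (outer_boundary G (F \<union> B)) \<le> s"
      by (rule card_le_of_subset_searchers)
  qed
  show "parcs G `` (F \<union> A) \<subseteq> prot c'"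
    using nb sent unfolding prot' by blast
  show "prot c' - (F \<union> A) \<subseteq> place c' ` {..<s}"
  proof
    fix w assume w: "w \<in> prot c' - (F \<union> A)"
    show "w \<in> place c' ` {..<s}"
    proof (cases "w \<in> prot c")
      case True
      then obtain i where i: "i < s" "place c i = w" using occ w by auto
      \<comment> \<open>The only vertex that could move \<open>i\<close> is the one it stands on,
        namely \<open>w\<close>, and \<open>w\<close> does not fire.\<close>
      then have "\<nexists>v. fires k s G c v \<and> i \<in> mobile_on k s c v"
        using w by (auto simp: A_def mobile_on_def)
      then have "stays c c' i" using st i(1) by (simp add: stage_def)
      then show ?thesis using i by (auto simp: stays_def intro!: image_eqI[of _ _ i])
    next
      case False
      then show ?thesis using w unfolding prot' by blast
    qed
  qed
qed

lemma successful_layout_imp_sweep: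
  assumes G: "pair_graph G" and L: "successful_layout k s G L"
  shows "sweep s G (pverts G)"
proof -
  interpret pair_graph G by fact
  have fin: "finite (pverts G)" by (rule pair_finite_verts)
  from L obtain c where run: "(stage k s G)\<^sup>*\<^sup>* (initial_state s L) c" and all: "pverts G \<subseteq> prot c"
    by (auto simp: successful_layout_def)
  from run have "\<exists>F. sweep s G F \<and> parcs G `` F \<subseteq> prot c \<and>
      prot c - F \<subseteq> place c ` {..<s}"
  proof (induction rule: rtranclp_induct)
    case base
    show ?case
      by (rule exI[of _ "{}"]) (auto simp: initial_state_def intro: sweep.empty)
  next
    case (step c c')
    then obtain F where "sweep s G F" "parcs G `` F \<subseteq> prot c"
      "prot c - F \<subseteq> place c ` {..<s}"
      by blast
    from sweep_stage[OF fin step.hyps(2) this] show ?case by blast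
  qed
  then obtain F where F: "sweep s G F" and occ: "prot c - F \<subseteq> place c ` {..<s}" by blast
  have FV: "F \<subseteq> pverts G" using F by induction auto
  \<comment> \<open>The vertices that never fire can come in any order: at the end each of them is
    protected, hence occupied, so even all of them together number at most \<open>s\<close>.\<close>
  have "sweep s G (F \<union> (pverts G - F))"
  proof (rule sweep_union[OF F])
    fix B
    have "outer_boundary G (F \<union> B) \<subseteq> pverts G - F"
      by (auto simp: outer_boundary_def dest: wellformed')
    then have "outer_boundary G (F \<union> B) \<subseteq> place c ` {..<s}"
      using occ all by blast
    then show "card (outer_boundary G (F \<union> B)) \<le> s"
      by (rule card_le_of_subset_searchers)
  qed (use fin in auto)
  then show ?thesis using FV by (simp add: Un_absorb1)
qed

section \<open>Boundaries in connected graphs and in products\<close>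

lemma outer_boundary_nonempty:
  assumes "pair_graph G" "connected G"
    and "X \<subseteq> pverts G" "X \<noteq> {}" "X \<noteq> pverts G"
  shows "outer_boundary G X \<noteq> {}"
proof
  interpret pair_graph G by fact
  assume bd: "outer_boundary G X = {}"
  obtain a b where a: "a \<in> X" "a \<in> pverts G" and b: "b \<in> pverts G" "b \<notin> X"
    using assms by blast
  \<comment> \<open>Symmetry of the arcs turns connectedness into directed reachability, under which
    a set with empty outer boundary is closed.\<close>
  have "strongly_connected G"
    using symmetric_connected_imp_strongly_connected pair_sym_arcs assms(2) by blast
  then have "a \<rightarrow>\<^sup>*\<^bsub>G\<^esub> b"
    using a b by (auto simp: strongly_connected_def)
  then have "b \<in> X"
    by (induction rule: reachable_induct) (use a bd in \<open>auto simp: outer_boundary_def\<close>)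
  then show False using b by simp
qed

lemma card_outer_boundary_singleton:
  assumes "pair_graph G" "x \<in> pverts G"
  shows "min_degree G \<le> card (outer_boundary G {x})"
proof -
  interpret pair_graph G by fact
  \<comment> \<open>As there are no loops, removing \<open>x\<close> from its own neighbourhood
    discards nothing.\<close>
  have "out_arcs G x = Pair x ` outer_boundary G {x}"
    using pair_no_loops[of "(x, x)"] by (auto simp: out_arcs_def outer_boundary_def image_iff)
  then have "out_degree G x = card (outer_boundary G {x})"
    by (simp add: out_degree_def card_image inj_on_def)
  then show ?thesis
    using assms(2) pair_finite_verts by (metis Min_le finite_imageI imageI min_degree_def)
qed

lemma card_ge_of_fibres:
  assumes "finite B" "finite Y" "y \<in> Y" "d \<le> card {b \<in> B. f b = y}"
    and "\<And>z. z \<in> Y \<Longrightarrow> z \<noteq> y \<Longrightarrow> \<exists>b \<in> B. f b = z"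
  shows "card Y + d - 1 \<le> card B"
proof -
  have "Y - {y} \<subseteq> f ` {b \<in> B. f b \<noteq> y}"
    using assms(5) by fastforce
  then have "card (Y - {y}) \<le> card {b \<in> B. f b \<noteq> y}"
    using assms(1) by (intro surj_card_le) auto
  moreover have "card B = card {b \<in> B. f b = y} + card {b \<in> B. f b \<noteq> y}"
    using assms(1) by (subst card_Un_disjoint[symmetric]) (auto intro: arg_cong[of _ _ card])
  \<comment> \<open>\<open>card Y\<close> is positive because \<open>y \<in> Y\<close>, so the
    truncated subtraction is exact.\<close>
  ultimately show ?thesis
    using assms(2-4) by simp
qed

text \<open>The boundary is counted along the fibres of \<open>snd\<close>, the copies of
  \<open>G\<close>: the copy at \<open>y\<close> contributes the neighbours of its single vertex in
  \<open>F\<close>, every other copy at least one vertex by connectedness.\<close>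

lemma card_outer_boundary_product:
  assumes G: "pair_graph G" "connected G" and H: "pair_graph H"
    and F: "F \<subseteq> pverts G \<times> pverts H" and meets: "snd ` F = pverts H"
    and new: "x \<in> pverts G" "{u. (u, y) \<in> F} = {x}"
    and proper: "\<And>z. z \<in> pverts H \<Longrightarrow> z \<noteq> y \<Longrightarrow> \<not> pverts G \<times> {z} \<subseteq> F"
  shows "card (pverts H) + min_degree G - 1 \<le> card (outer_boundary (cartesian_product G H) F)"
    (is "_ \<le> card ?B")
proof (rule card_ge_of_fibres[where f = snd])
  interpret H: pair_graph H by fact
  interpret P: pair_graph "cartesian_product G H"
    using pair_graph_cartesian_product G H by blast
  show fin: "finite ?B"
    by (rule finite_subset[OF _ P.pair_finite_verts])
       (auto simp: outer_boundary_def dest: P.wellformed')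
  show "finite (pverts H)" by (rule H.pair_finite_verts)
  have "(x, y) \<in> F" using new(2) by auto
  then show "y \<in> pverts H" using F by auto
  \<comment> \<open>A boundary taken inside one copy of \<open>G\<close> is part of the boundary in
    the product, so each copy can be treated separately.\<close>
  have copy: "(u, z) \<in> ?B" if "u \<in> outer_boundary G {u. (u, z) \<in> F}" "z \<in> pverts H" for u z
    using that by (fastforce simp: outer_boundary_def cartesian_product_def)
  have "(\<lambda>u. (u, y)) ` outer_boundary G {x} \<subseteq> {b \<in> ?B. snd b = y}"
    using copy[of _ y] new(2) \<open>y \<in> pverts H\<close> by auto
  then have "card (outer_boundary G {x}) \<le> card {b \<in> ?B. snd b = y}"
    using fin by (intro card_inj_on_le[of "\<lambda>u. (u, y)"]) (auto simp: inj_on_def)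
  then show "min_degree G \<le> card {b \<in> ?B. snd b = y}"
    using card_outer_boundary_singleton[OF G(1) new(1)] by simp
  fix z assume z: "z \<in> pverts H" "z \<noteq> y"
  have "outer_boundary G {u. (u, z) \<in> F} \<noteq> {}"
  proof (rule outer_boundary_nonempty[OF G])
    show "{u. (u, z) \<in> F} \<subseteq> pverts G" using F by auto
    have "z \<in> snd ` F" using z meets by simp
    then show "{u. (u, z) \<in> F} \<noteq> {}" by force
    show "{u. (u, z) \<in> F} \<noteq> pverts G" using proper[OF z] by auto
  qed
  then show "\<exists>b \<in> ?B. snd b = z" using copy z(1) by fastforce
qed

text \<open>The coordinate swap is an isomorphism between the two products; it reduces the count
  along copies of \<open>H\<close> to the count along copies of \<open>G\<close>.\<close>

lemma card_outer_boundary_cartesian_product_commute: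
  "card (outer_boundary (cartesian_product H G) (prod.swap ` F)) =
    card (outer_boundary (cartesian_product G H) F)"
proof -
  have "parcs (cartesian_product H G) `` (prod.swap ` F) =
      prod.swap ` (parcs (cartesian_product G H) `` F)"
    by (fastforce simp: cartesian_product_def)
  then have "outer_boundary (cartesian_product H G) (prod.swap ` F) =
      prod.swap ` outer_boundary (cartesian_product G H) F"
    by (simp add: outer_boundary_def image_set_diff)
  then show ?thesis by (simp add: card_image)
qed

text \<open>Only the step at which a projection of \<open>F\<close> first becomes surjective needs
  an estimate. With the bound on \<open>s\<close> as an alternative, the statement persists through
  all later steps.\<close>

lemma sweep_cartesian_product:
  assumes G: "pair_graph G" "connected G" "pverts G \<noteq> {}"
    and H: "pair_graph H" "connected H" "pverts H \<noteq> {}"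
    and "sweep s (cartesian_product G H) F"
  shows "F \<subseteq> pverts G \<times> pverts H \<and>
    (fst ` F \<noteq> pverts G \<and> snd ` F \<noteq> pverts H \<or>
     min (card (pverts H) + min_degree G - 1) (card (pverts G) + min_degree H - 1) \<le> s)"
  using assms(7)
proof induction
  case empty
  then show ?case using G H by auto
next
  case (insert F v)
  obtain x y where v: "v = (x, y)" by fastforce
  then have xy: "x \<in> pverts G" "y \<in> pverts H"
    using insert.hyps by (auto simp: cartesian_product_def)
  let ?F = "insert v F"
  have F: "F \<subseteq> pverts G \<times> pverts H" and F': "?F \<subseteq> pverts G \<times> pverts H"
    using insert.IH v xy by auto
  show ?case
  proof (cases "fst ` F \<noteq> pverts G \<and> snd ` F \<noteq> pverts H")
    case False
    then show ?thesis using insert.IH F' by auto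
  next
    case True
    \<comment> \<open>A full copy of \<open>G\<close> inside \<open>F\<close> would already project
      onto all of \<open>pverts G\<close>; likewise for \<open>H\<close>.\<close>
    have rows: "\<not> pverts G \<times> {z} \<subseteq> F" for z
      using True F by force
    have cols: "\<not> {z} \<times> pverts H \<subseteq> F" for z
      using True F by force
    consider "fst ` ?F \<noteq> pverts G \<and> snd ` ?F \<noteq> pverts H"
      | "snd ` ?F = pverts H" | "fst ` ?F = pverts G" by blast
    then show ?thesis
    proof cases
      case 1
      then show ?thesis using F' by blast
    next
      case 2
      \<comment> \<open>Adding \<open>v\<close> changed the second projection, so \<open>v\<close>
        is the first vertex of its copy of \<open>G\<close> to enter.\<close>
      then have "y \<notin> snd ` F" using True v by (auto simp: insert_absorb)
      then have new: "{u. (u, y) \<in> ?F} = {x}" using v by force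
      have "\<not> pverts G \<times> {z} \<subseteq> ?F" if "z \<noteq> y" for z
        using rows[of z] that v by auto
      then have "card (pverts H) + min_degree G - 1 \<le> s"
        using card_outer_boundary_product[OF G(1,2) H(1) F' 2 xy(1) new] insert.hyps(4) by simp
      then show ?thesis using F' by auto
    next
      case 3
      let ?S = "prod.swap ` ?F"
      have S: "?S \<subseteq> pverts H \<times> pverts G" "snd ` ?S = pverts G"
        using F' 3 by (auto simp: image_image)
      have "x \<notin> fst ` F" using 3 True v by (auto simp: insert_absorb)
      then have new: "{u. (u, x) \<in> ?S} = {y}" using v by force
      have "\<not> pverts H \<times> {z} \<subseteq> ?S" if "z \<noteq> x" for z
        using cols[of z] that v by auto
      then have "card (pverts G) + min_degree H - 1 \<le> s"
        using card_outer_boundary_product[OF H(1,2) G(1) S xy(2) new] insert.hyps(4)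
        by (simp add: card_outer_boundary_cartesian_product_commute del: image_insert)
      then show ?thesis using F' by auto
    qed
  qed
qed

theorem theorem4p1:
  fixes G :: "'a pair_pre_digraph" and H :: "'b pair_pre_digraph" and m n k :: nat
  assumes "2 \<le> m" and "m \<le> n"
    and "pair_graph G" and "connected G" and "card (pverts G) = m"
    and "pair_graph H" and "connected H" and "card (pverts H) = n"
    and "1 \<le> k"
  shows "deduction_number k (cartesian_product G H)
           \<ge> min (n + min_degree G - 1) (m + min_degree H - 1)"
proof -
  let ?P = "cartesian_product G H"
  have P: "pair_graph ?P" and V: "pverts ?P = pverts G \<times> pverts H"
    using pair_graph_cartesian_product assms by (auto simp: cartesian_product_def)
  interpret P: pair_graph ?P by (rule P)
  have "sweep (deduction_number k ?P) ?P (pverts ?P)"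
    using deduction_number_attained[OF P.pair_finite_verts] successful_layout_imp_sweep[OF P]
    by blast
  moreover have ne: "pverts G \<noteq> {}" "pverts H \<noteq> {}" using assms by auto
  \<comment> \<open>A surjective projection of the whole vertex set rules out the first alternative
    of the induction.\<close>
  moreover have "fst ` pverts ?P = pverts G" using V ne by simp
  ultimately show ?thesis
    using sweep_cartesian_product[of G H "deduction_number k ?P" "pverts ?P"] assms by auto
qed

end
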